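(* Let $\mu_1,\dots,\mu_j\in\mathcal D$ be the parameters used to construct the subspace $\mathcal V_j$, and let $\rho^{(j)}(\mu)=\|(I-U_j(\mu)U_j(\mu)^* )A(\mu)U_j(\mu)\|$, where $U_j(\mu)$ is the matrix of lifted eigenvectors of the projected matrix $V_j^*A(\mu)V_j$ corresponding to its $r$ smallest eigenvalues. Then $\rho^{(j)}(\mu_i)=0$ for every $i\in\{1,\dots,j\}$.
   Context: Let $\mathcal D\subset\mathbb R^p$ be compact and $A(\mu)=\sum_{m=1}^{\kappa}\theta_m(\mu)A_m$ with $A_m\in\mathbb C^{n\times n}$ Hermitian and $\theta_m:\mathbb R^p\to\mathbb R$ real analytic. Fix integers $1\le r\le \ell<n$ and points $\mu_1,\dots,\mu_j\in\mathcal D$. For $i=1,\dots,j$, let $\lambda^{(i)}_1\le\lambda^{(i)}_2\le\cdots$ be the eigenvalues of $A(\mu_i)$ in increasing order, counted with multiplicity, and let $v^{(i)}_1,\dots,v^{(i)}_\ell$ be orthonormal eigenvectors of $A(\mu_i)$ corresponding to $\lambda^{(i)}_1,\dots,\lambda^{(i)}_\ell$. Set $\mathcal V_j=\mathrm{span}\{v^{(i)}_k: 1\le i\le j,\ 1\le k\le \ell\}$ and let $V_j$ be a matrix whose columns form an orthonormal basis of $\mathcal V_j$. For $\mu\in\mathcal D$, let $\lambda^{\mathcal V_j}_k(\mu)$ be the $k$-th smallest eigenvalue of $V_j^*A(\mu)V_j$ and $w^{V_j}_1(\mu),\dots,w^{V_j}_r(\mu)$ orthonormal eigenvectors of $V_j^*A(\mu)V_j$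 corresponding to its $r$ smallest eigenvalues. Define $U_j(\mu)=[\,V_jw^{V_j}_1(\mu),\dots,V_jw^{V_j}_r(\mu)\,]\in\mathbb C^{n\times r}$. The norm $\|\cdot\|$ is the spectral norm. Equivalently, $\rho^{(j)}(\mu)=\|U_j^\perp(\mu)^*A(\mu)U_j(\mu)\|$, where the columns of $U_j^\perp(\mu)$ form an orthonormal basis of the orthogonal complement of the column space of $U_j(\mu)$. *)

theory Defs
  imports
    "HOL-Analysis.Analysis"
    "Jordan_Normal_Form.Schur_Decomposition"
    "Jordan_Normal_Form.VS_Connect"
begin

text \<open>Matrices and vectors over the complex numbers are those of Jordan_Normal_Form, since the
  number of columns of the reduced basis depends on the data; only the parameter
  \<open>\<mu>\<close> lives in \<open>real ^ 'p\<close>.  Families such as \<open>\<lambda>\<^sub>1 \<le> \<lambda>\<^sub>2 \<le> \<dots>\<close> are indexed from 1;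
  columns and entries of matrices are indexed from 0 as in the library.\<close>

no_notation vec_nth (infixl \<open>$\<close> 90)

text \<open>Local expansion into an (unconditionally, hence absolutely) convergent power series in
  \<open>CARD('p)\<close> variables; the functions \<open>\<alpha> :: 'p \<Rightarrow> nat\<close> are the multi-indices.\<close>

definition real_analytic :: "(real ^ 'p \<Rightarrow> real) \<Rightarrow> bool" where
  "real_analytic f \<longleftrightarrow>
    (\<forall>x. \<exists>c. \<exists>e>0. \<forall>y\<in>ball x e.
      ((\<lambda>\<alpha>. c \<alpha> * (\<Prod>i\<in>UNIV. (vec_nth y i - vec_nth x i) ^ \<alpha> i)) has_sum f y) UNIV)"

definition hermitian_mat :: "complex mat \<Rightarrow> bool" where
  "hermitian_mat A \<longleftrightarrow> square_mat A \<and> mat_adjoint A = A"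

definition param_mat ::
    "nat \<Rightarrow> nat \<Rightarrow> (nat \<Rightarrow> real ^ 'p \<Rightarrow> real) \<Rightarrow> (nat \<Rightarrow> complex mat) \<Rightarrow> real ^ 'p \<Rightarrow> complex mat" where
  "param_mat n \<kappa> \<theta> A \<mu> =
    mat n n (\<lambda>(a, b). \<Sum>m = 1..\<kappa>. complex_of_real (\<theta> m \<mu>) * A m $$ (a, b))"

text \<open>The \<open>k\<close>-th smallest eigenvalue (\<open>k \<ge> 1\<close>), counted with multiplicity.  It is meant for Hermitian
  matrices, whose eigenvalues are real, so that \<^const>\<open>Re\<close> is only a coercion.\<close>

definition eigenvalue_list :: "complex mat \<Rightarrow> real list" where
  "eigenvalue_list A = sorted_list_of_multiset (image_mset Re (proots (char_poly A)))"

definition kth_eigenvalue :: "complex mat \<Rightarrow> nat \<Rightarrow> real" where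
  "kth_eigenvalue A k = eigenvalue_list A ! (k - 1)"

definition orthonormal_vecs :: "nat \<Rightarrow> nat set \<Rightarrow> (nat \<Rightarrow> complex vec) \<Rightarrow> bool" where
  "orthonormal_vecs n I f \<longleftrightarrow>
    (\<forall>k\<in>I. f k \<in> carrier_vec n) \<and>
    (\<forall>k\<in>I. \<forall>l\<in>I. f k \<bullet>c f l = (if k = l then 1 else 0))"

definition lowest_eigenvectors :: "complex mat \<Rightarrow> nat \<Rightarrow> (nat \<Rightarrow> complex vec) \<Rightarrow> bool" where
  "lowest_eigenvectors A q f \<longleftrightarrow>
    orthonormal_vecs (dim_row A) {1..q} f \<and>
    (\<forall>k\<in>{1..q}. eigenvector A (f k) (complex_of_real (kth_eigenvalue A k)))"

abbreviation cspan :: "nat \<Rightarrow> complex vec set \<Rightarrow> complex vec set" where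
  "cspan n \<equiv> LinearCombinations.module.span class_ring (module_vec TYPE(complex) n)"

definition orthonormal_basis_mat :: "nat \<Rightarrow> complex vec set \<Rightarrow> complex mat \<Rightarrow> bool" where
  "orthonormal_basis_mat n W V \<longleftrightarrow>
    dim_row V = n \<and> orthonormal_vecs n {..<dim_col V} (col V) \<and> cspan n (set (cols V)) = W"

definition lifted_mat :: "complex mat \<Rightarrow> nat \<Rightarrow> (nat \<Rightarrow> complex vec) \<Rightarrow> complex mat" where
  "lifted_mat V r w = mat_of_cols (dim_row V) (map (\<lambda>k. V *\<^sub>v w k) [1..<Suc r])"

definition euclid_norm :: "complex vec \<Rightarrow> real" where
  "euclid_norm x = sqrt (\<Sum>i<dim_vec x. (cmod (x $ i))\<^sup>2)"

definition spectral_norm :: "complex mat \<Rightarrow> real" where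
  "spectral_norm M =
    Sup {euclid_norm (M *\<^sub>v x) | x. x \<in> carrier_vec (dim_col M) \<and> euclid_norm x \<le> 1}"

definition residual_norm :: "complex mat \<Rightarrow> complex mat \<Rightarrow> real" where
  "residual_norm A U = spectral_norm ((1\<^sub>m (dim_row U) - U * mat_adjoint U) * A * U)"

end

(*
  Deflation: if the v_k are orthonormal eigenvectors of A for the eigenvalues a_k, then adding
  c_k v_k v_k^* for every k replaces the roots a_k of the characteristic polynomial by a_k + c_k.
  Lifting lambda_1, ..., lambda_l to lambda_l in A shows that <Au, u> >= lambda_l |u|^2 for u
  orthogonal to v_1, ..., v_l, with equality only if Au = lambda_l u.  Deflating the compression
  B = V^* A V along the vectors V^* v_k shows that the l smallest eigenvalues of B are at most lambda_l.

  Let Bw = lambda w with lambda <= lambda_l, put u = Vw and let q be the component of u orthogonal to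
  v_1, ..., v_l.  Then Au - lambda u = Aq - lambda q is orthogonal to the range of V, which contains q,
  so <Aq, q> = lambda |q|^2.  By the Rayleigh bound, q vanishes or lambda = lambda_l; in both cases
  Aq = lambda q, hence Au = lambda u.  So the columns of U are eigenvectors of A and the residual is 0.
*)

theory Submission
  imports Defs
begin

section \<open>Adjoints, Hermitian matrices and the complex inner product\<close>

lemma mat_adjoint_index:
  "i < dim_col A \<Longrightarrow> j < dim_row A \<Longrightarrow> mat_adjoint A $$ (i, j) = conjugate (A $$ (j, i))"
  by (simp add: mat_adjoint_def mat_of_rows_def)

lemma mat_adjoint_dim [simp]:
  "dim_row (mat_adjoint A) = dim_col A" "dim_col (mat_adjoint A) = dim_row A"
  by (simp_all add: mat_adjoint_def)

lemma mat_adjoint_carrier [simp]: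
  "A \<in> carrier_mat nr nc \<Longrightarrow> mat_adjoint A \<in> carrier_mat nc nr"
  by auto

lemma mat_adjoint_mult_vec_carrier [simp]:
  "A \<in> carrier_mat nr nc \<Longrightarrow> mat_adjoint A *\<^sub>v x \<in> carrier_vec nc"
  by (metis mat_adjoint_carrier mult_mat_vec_carrier carrier_vec_dim_vec dim_mult_mat_vec carrier_matD(1))

lemma cscalar_prod_conv_sum:
  "x \<in> carrier_vec n \<Longrightarrow> y \<in> carrier_vec n \<Longrightarrow> x \<bullet>c y = (\<Sum>i<n. x $ i * conjugate (y $ i))"
  by (auto simp: scalar_prod_def atLeast0LessThan)

lemma mult_mat_vec_conv_sum:
  "A \<in> carrier_mat nr nc \<Longrightarrow> x \<in> carrier_vec nc \<Longrightarrow> i < nr \<Longrightarrow>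
    (A *\<^sub>v x) $ i = (\<Sum>j<nc. A $$ (i, j) * x $ j)"
  by (auto simp: scalar_prod_def atLeast0LessThan)

lemma cscalar_prod_mat_adjoint:
  fixes A :: "complex mat"
  assumes A: "A \<in> carrier_mat nr nc" and x: "x \<in> carrier_vec nc" and y: "y \<in> carrier_vec nr"
  shows "(A *\<^sub>v x) \<bullet>c y = x \<bullet>c (mat_adjoint A *\<^sub>v y)"
proof -
  have "(A *\<^sub>v x) \<bullet>c y = (\<Sum>i<nr. \<Sum>j<nc. A $$ (i, j) * x $ j * cnj (y $ i))"
    using assms by (simp add: cscalar_prod_conv_sum[of _ nr] mult_mat_vec_conv_sum[OF A x]
        sum_distrib_right del: index_mult_mat_vec)
  also have "\<dots> = (\<Sum>j<nc. \<Sum>i<nr. A $$ (i, j) * x $ j * cnj (y $ i))"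
    by (rule sum.swap)
  also have "\<dots> = (\<Sum>j<nc. x $ j * cnj ((mat_adjoint A *\<^sub>v y) $ j))"
    using assms by (intro sum.cong refl) (simp add: mult_mat_vec_conv_sum[of _ nc nr] mat_adjoint_index
        sum_distrib_left mult_ac del: index_mult_mat_vec)
  also have "\<dots> = x \<bullet>c (mat_adjoint A *\<^sub>v y)"
    using assms by (subst cscalar_prod_conv_sum[of _ nc]) auto
  finally show ?thesis .
qed

lemma hermitian_cscalar_prod:
  assumes "hermitian_mat A" "A \<in> carrier_mat n n" "x \<in> carrier_vec n" "y \<in> carrier_vec n"
  shows "(A *\<^sub>v x) \<bullet>c y = x \<bullet>c (A *\<^sub>v y)"
  using cscalar_prod_mat_adjoint[of A n n x y] assms by (simp add: hermitian_mat_def)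

lemma hermitian_matI:
  assumes "A \<in> carrier_mat n n"
    and "\<And>i j. i < n \<Longrightarrow> j < n \<Longrightarrow> A $$ (j, i) = cnj (A $$ (i, j))"
  shows "hermitian_mat A"
proof -
  have "mat_adjoint A = A"
  proof (rule eq_matI)
    fix i j assume "i < dim_row A" "j < dim_col A"
    then show "mat_adjoint A $$ (i, j) = A $$ (i, j)"
      using assms(1) assms(2)[of j i] by (simp add: mat_adjoint_index)
  qed (use assms(1) in auto)
  with assms(1) show ?thesis by (auto simp: hermitian_mat_def square_mat.simps)
qed

lemma hermitian_mat_index:
  assumes "hermitian_mat A" "A \<in> carrier_mat n n" "i < n" "j < n"
  shows "A $$ (j, i) = cnj (A $$ (i, j))"
  using assms mat_adjoint_index[of j A i] by (auto simp: hermitian_mat_def)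

lemma cscalar_prod_swap:
  fixes x :: "complex vec"
  assumes "x \<in> carrier_vec n" "y \<in> carrier_vec n"
  shows "y \<bullet>c x = cnj (x \<bullet>c y)"
  using assms by (simp add: cscalar_prod_conv_sum[of _ n] mult.commute)

lemma cscalar_prod_self:
  fixes x :: "complex vec"
  assumes "x \<in> carrier_vec n"
  shows "x \<bullet>c x = complex_of_real (\<Sum>i<n. (cmod (x $ i))\<^sup>2)"
  using assms by (simp add: cscalar_prod_conv_sum[of _ n] complex_mult_cnj cmod_power2)

lemma cscalar_prod_self_Re:
  fixes x :: "complex vec"
  assumes "x \<in> carrier_vec n"
  shows "0 \<le> Re (x \<bullet>c x)" and "Re (x \<bullet>c x) = 0 \<longleftrightarrow> x = 0\<^sub>v n"
proof -
  have eq: "Re (x \<bullet>c x) = (\<Sum>i<n. (cmod (x $ i))\<^sup>2)"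
    using cscalar_prod_self[OF assms] by simp
  show "0 \<le> Re (x \<bullet>c x)" unfolding eq by (simp add: sum_nonneg)
  show "Re (x \<bullet>c x) = 0 \<longleftrightarrow> x = 0\<^sub>v n"
    unfolding eq using assms by (auto simp: sum_nonneg_eq_0_iff intro!: eq_vecI)
qed

section \<open>Linear combinations of indexed families\<close>

text \<open>Coefficients belong to indices and not to vectors, so a family can be mapped through a
  matrix without asking whether its members stay distinct. The entrywise form reduces each rule to
  an exchange of finite sums.\<close>

definition lincomb_vec :: "nat \<Rightarrow> nat set \<Rightarrow> (nat \<Rightarrow> complex) \<Rightarrow> (nat \<Rightarrow> complex vec) \<Rightarrow> complex vec" where
  "lincomb_vec n I c f = vec n (\<lambda>i. \<Sum>k\<in>I. c k * f k $ i)"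

lemma lincomb_vec_carrier [simp]: "lincomb_vec n I c f \<in> carrier_vec n"
  by (simp add: lincomb_vec_def)

lemma lincomb_vec_dim [simp]: "dim_vec (lincomb_vec n I c f) = n"
  by (simp add: lincomb_vec_def)

lemma lincomb_vec_index: "i < n \<Longrightarrow> lincomb_vec n I c f $ i = (\<Sum>k\<in>I. c k * f k $ i)"
  by (simp add: lincomb_vec_def)

lemma lincomb_vec_cong:
  "(\<And>k. k \<in> I \<Longrightarrow> c k = d k) \<Longrightarrow> lincomb_vec n I c f = lincomb_vec n I d f"
  by (simp add: lincomb_vec_def)

lemma lincomb_vec_zero: "(\<And>k. k \<in> I \<Longrightarrow> c k = 0) \<Longrightarrow> lincomb_vec n I c f = 0\<^sub>v n"
  by (auto simp: lincomb_vec_def)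

lemma lincomb_vec_single:
  assumes "finite I" "m \<in> I" "\<And>k. k \<in> I \<Longrightarrow> k \<noteq> m \<Longrightarrow> c k = 0" "f m \<in> carrier_vec n"
  shows "lincomb_vec n I c f = c m \<cdot>\<^sub>v f m"
proof (rule eq_vecI)
  fix i assume "i < dim_vec (c m \<cdot>\<^sub>v f m)"
  with assms(4) have i: "i < n" by auto
  have "(\<Sum>k\<in>I. c k * f k $ i) = (\<Sum>k\<in>{m}. c k * f k $ i)"
    using assms by (intro sum.mono_neutral_right) auto
  with i assms(4) show "lincomb_vec n I c f $ i = (c m \<cdot>\<^sub>v f m) $ i"
    by (simp add: lincomb_vec_index)
qed (use assms(4) in auto)

lemma smult_lincomb_vec: "a \<cdot>\<^sub>v lincomb_vec n I c f = lincomb_vec n I (\<lambda>k. a * c k) f"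
  by (rule eq_vecI) (auto simp: lincomb_vec_index sum_distrib_left mult_ac)

lemma mult_mat_lincomb_vec:
  assumes A: "A \<in> carrier_mat m n" and f: "\<And>k. k \<in> I \<Longrightarrow> f k \<in> carrier_vec n"
  shows "A *\<^sub>v lincomb_vec n I c f = lincomb_vec m I c (\<lambda>k. A *\<^sub>v f k)"
proof (rule eq_vecI)
  fix i assume "i < dim_vec (lincomb_vec m I c (\<lambda>k. A *\<^sub>v f k))"
  then have i: "i < m" by simp
  have "(A *\<^sub>v lincomb_vec n I c f) $ i = (\<Sum>j<n. \<Sum>k\<in>I. c k * (A $$ (i, j) * f k $ j))"
    using i A by (subst mult_mat_vec_conv_sum[OF A])
      (auto simp: lincomb_vec_index sum_distrib_left mult_ac)
  also have "\<dots> = (\<Sum>k\<in>I. \<Sum>j<n. c k * (A $$ (i, j) * f k $ j))"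
    by (rule sum.swap)
  also have "\<dots> = (\<Sum>k\<in>I. c k * (A *\<^sub>v f k) $ i)"
    by (intro sum.cong refl, subst mult_mat_vec_conv_sum[OF A f i]) (auto simp: sum_distrib_left)
  finally show "(A *\<^sub>v lincomb_vec n I c f) $ i = lincomb_vec m I c (\<lambda>k. A *\<^sub>v f k) $ i"
    using i by (simp add: lincomb_vec_index)
qed (use A in auto)

lemma lincomb_vec_eigen:
  assumes "\<And>k. k \<in> I \<Longrightarrow> f k \<in> carrier_vec n" "\<And>k. k \<in> I \<Longrightarrow> g k = a k \<cdot>\<^sub>v f k"
  shows "lincomb_vec n I c g = lincomb_vec n I (\<lambda>k. c k * a k) f"
proof (rule eq_vecI)
  fix i assume "i < dim_vec (lincomb_vec n I (\<lambda>k. c k * a k) f)"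
  then have i: "i < n" by simp
  have "c k * g k $ i = c k * a k * f k $ i" if "k \<in> I" for k
    using assms(1)[OF that] assms(2)[OF that] i by simp
  then have "(\<Sum>k\<in>I. c k * g k $ i) = (\<Sum>k\<in>I. c k * a k * f k $ i)"
    by (intro sum.cong refl)
  with i show "lincomb_vec n I c g $ i = lincomb_vec n I (\<lambda>k. c k * a k) f $ i"
    by (simp add: lincomb_vec_index)
qed simp

lemma lincomb_vec_cscalar_prod:
  assumes f: "\<And>k. k \<in> I \<Longrightarrow> f k \<in> carrier_vec n" and y: "y \<in> carrier_vec n"
  shows "lincomb_vec n I c f \<bullet>c y = (\<Sum>k\<in>I. c k * (f k \<bullet>c y))"
proof -
  have "lincomb_vec n I c f \<bullet>c y = (\<Sum>i<n. \<Sum>k\<in>I. c k * (f k $ i * cnj (y $ i)))"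
    using y by (subst cscalar_prod_conv_sum[of _ n])
      (auto simp: lincomb_vec_index sum_distrib_right mult.assoc)
  also have "\<dots> = (\<Sum>k\<in>I. \<Sum>i<n. c k * (f k $ i * cnj (y $ i)))"
    by (rule sum.swap)
  also have "\<dots> = (\<Sum>k\<in>I. c k * (f k \<bullet>c y))"
    using y by (intro sum.cong refl, subst cscalar_prod_conv_sum[OF f y])
      (auto simp: sum_distrib_left)
  finally show ?thesis .
qed

section \<open>Deflation and its effect on the characteristic polynomial\<close>

text \<open>This is A plus the rank-one matrices c_k f_k f_k^*; for orthonormal eigenvectors f_k it
  is Hotelling deflation.\<close>

definition deflate ::
  "complex mat \<Rightarrow> nat set \<Rightarrow> (nat \<Rightarrow> complex) \<Rightarrow> (nat \<Rightarrow> complex vec) \<Rightarrow> complex mat" where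
  "deflate A I c f = mat (dim_row A) (dim_col A)
    (\<lambda>(i, j). A $$ (i, j) + (\<Sum>k\<in>I. c k * f k $ i * cnj (f k $ j)))"

lemma deflate_carrier [simp]: "A \<in> carrier_mat n m \<Longrightarrow> deflate A I c f \<in> carrier_mat n m"
  by (auto simp: deflate_def)

lemma deflate_mult_vec:
  assumes A: "A \<in> carrier_mat n n" and f: "\<And>k. k \<in> I \<Longrightarrow> f k \<in> carrier_vec n"
    and u: "u \<in> carrier_vec n"
  shows "deflate A I c f *\<^sub>v u = A *\<^sub>v u + lincomb_vec n I (\<lambda>k. c k * (u \<bullet>c f k)) f"
proof (rule eq_vecI)
  fix i assume "i < dim_vec (A *\<^sub>v u + lincomb_vec n I (\<lambda>k. c k * (u \<bullet>c f k)) f)"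
  then have i: "i < n" by simp
  have "(deflate A I c f *\<^sub>v u) $ i = (\<Sum>j<n. A $$ (i, j) * u $ j) +
      (\<Sum>j<n. \<Sum>k\<in>I. c k * f k $ i * (u $ j * cnj (f k $ j)))"
  proof -
    have "deflate A I c f $$ (i, j) * u $ j =
        A $$ (i, j) * u $ j + (\<Sum>k\<in>I. c k * f k $ i * (u $ j * cnj (f k $ j)))" if "j < n" for j
      using that i A by (auto simp: deflate_def distrib_right sum_distrib_right mult_ac distrib_left sum_distrib_left)
    then show ?thesis
      by (subst mult_mat_vec_conv_sum[OF deflate_carrier[OF A] u i]) (simp add: sum.distrib)
  qed
  also have "(\<Sum>j<n. \<Sum>k\<in>I. c k * f k $ i * (u $ j * cnj (f k $ j))) =
      (\<Sum>k\<in>I. \<Sum>j<n. c k * f k $ i * (u $ j * cnj (f k $ j)))"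
    by (rule sum.swap)
  also have "\<dots> = (\<Sum>k\<in>I. c k * (u \<bullet>c f k) * f k $ i)"
    by (intro sum.cong refl, subst cscalar_prod_conv_sum[OF u f])
      (auto simp: sum_distrib_left sum_distrib_right mult_ac)
  also have "(\<Sum>j<n. A $$ (i, j) * u $ j) = (A *\<^sub>v u) $ i"
    by (rule mult_mat_vec_conv_sum[OF A u i, symmetric])
  finally show "(deflate A I c f *\<^sub>v u) $ i =
      (A *\<^sub>v u + lincomb_vec n I (\<lambda>k. c k * (u \<bullet>c f k)) f) $ i"
    using i A by (simp add: lincomb_vec_index)
qed (use A in \<open>auto simp: deflate_def\<close>)

lemma hermitian_deflate:
  assumes A: "A \<in> carrier_mat n n" "hermitian_mat A" and c: "\<And>k. k \<in> I \<Longrightarrow> c k \<in> \<real>"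
  shows "hermitian_mat (deflate A I c f)"
proof (rule hermitian_matI[OF deflate_carrier[OF A(1)]])
  fix i j assume ij: "i < n" "j < n"
  have "(\<Sum>k\<in>I. c k * f k $ j * cnj (f k $ i)) = (\<Sum>k\<in>I. cnj (c k) * cnj (f k $ i) * f k $ j)"
    using c by (intro sum.cong) (auto simp: Reals_cnj_iff)
  with ij A hermitian_mat_index[OF A(2,1) ij]
  show "deflate A I c f $$ (j, i) = cnj (deflate A I c f $$ (i, j))"
    by (auto simp: deflate_def)
qed

lemma deflate_insert:
  assumes "finite I" "m \<notin> I"
  shows "deflate A (insert m I) c f = deflate (deflate A I c f) {m} c f"
  using assms by (auto simp: deflate_def)

lemma deflate_empty: "deflate A {} c f = A"
  by (auto simp: deflate_def)

text \<open>Both sides are the determinant of the bordered matrix with blocks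
  \<open>N\<close>, \<open>v\<close>, \<open>w\<^sup>T\<close>, \<open>1\<close>, computed by eliminating its last row and its last column.\<close>

lemma det_rank_one_update:
  fixes N :: "'a :: idom mat"
  assumes N: "N \<in> carrier_mat n n" and v: "v \<in> carrier_vec n" and w: "w \<in> carrier_vec n"
    and eig: "N *\<^sub>v v = a \<cdot>\<^sub>v v"
  shows "det (N - mat n n (\<lambda>(i, j). v $ i * w $ j)) * a = det N * (a - w \<bullet> v)"
proof -
  let ?O = "mat n n (\<lambda>(i, j). v $ i * w $ j)"
  let ?v = "mat n 1 (\<lambda>(i, j). v $ i)" and ?w = "mat 1 n (\<lambda>(i, j). w $ j)"
  let ?s = "\<lambda>c. mat 1 1 (\<lambda>_. c)"
  let ?M = "four_block_mat N ?v ?w (1\<^sub>m 1)"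
  have carr: "?O \<in> carrier_mat n n" "?v \<in> carrier_mat n 1" "?w \<in> carrier_mat 1 n"
    "\<And>c. ?s c \<in> carrier_mat 1 1" "N - ?O \<in> carrier_mat n n"
    using N by auto
  have "four_block_mat (1\<^sub>m n) ?v (0\<^sub>m 1 n) (1\<^sub>m 1) * four_block_mat (N - ?O) (0\<^sub>m n 1) ?w (1\<^sub>m 1) =
    four_block_mat (1\<^sub>m n * (N - ?O) + ?v * ?w) (1\<^sub>m n * 0\<^sub>m n 1 + ?v * 1\<^sub>m 1)
      (0\<^sub>m 1 n * (N - ?O) + 1\<^sub>m 1 * ?w) (0\<^sub>m 1 n * 0\<^sub>m n 1 + 1\<^sub>m 1 * 1\<^sub>m 1)"
    by (rule mult_four_block_mat) (use carr in auto)
  also have "1\<^sub>m n * (N - ?O) + ?v * ?w = N"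
  proof (rule eq_matI)
    fix i j assume "i < dim_row N" "j < dim_col N"
    with N show "(1\<^sub>m n * (N - ?O) + ?v * ?w) $$ (i, j) = N $$ (i, j)"
      using carr by (simp add: scalar_prod_def)
  qed (use N in auto)
  also have "1\<^sub>m n * 0\<^sub>m n 1 + ?v * 1\<^sub>m 1 = ?v" by auto
  also have "0\<^sub>m 1 n * (N - ?O) + 1\<^sub>m 1 * ?w = ?w"
    using carr by (simp add: left_mult_zero_mat[OF carr(5)])
  also have "0\<^sub>m 1 n * 0\<^sub>m n 1 + 1\<^sub>m 1 * 1\<^sub>m 1 = (1\<^sub>m 1 :: 'a mat)" by auto
  finally have "det ?M = det (four_block_mat (1\<^sub>m n) ?v (0\<^sub>m 1 n) (1\<^sub>m 1)) *
      det (four_block_mat (N - ?O) (0\<^sub>m n 1) ?w (1\<^sub>m 1))"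
    using det_mult[of "four_block_mat (1\<^sub>m n) ?v (0\<^sub>m 1 n) (1\<^sub>m 1)" "n + 1"
        "four_block_mat (N - ?O) (0\<^sub>m n 1) ?w (1\<^sub>m 1)"] carr
    by (metis four_block_carrier_mat one_carrier_mat)
  also have "det (four_block_mat (1\<^sub>m n) ?v (0\<^sub>m 1 n) (1\<^sub>m 1)) = 1"
    using carr by (subst det_four_block_mat_lower_left_zero[where n = n and m = 1]) auto
  also have "det (four_block_mat (N - ?O) (0\<^sub>m n 1) ?w (1\<^sub>m 1)) = det (N - ?O)"
    using carr by (subst det_four_block_mat_upper_right_zero[where n = n and m = 1]) auto
  finally have 1: "det ?M = det (N - ?O)" by simp
  \<comment> \<open>The last column (-v, a) is chosen so that \<open>eig\<close> annihilates the
    upper right block. Nothing is inverted, so the argument covers singular N and a = 0, at the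
    price of the factor a in the conclusion.\<close>
  have "?M * four_block_mat (1\<^sub>m n) (- ?v) (0\<^sub>m 1 n) (?s a) =
    four_block_mat (N * 1\<^sub>m n + ?v * 0\<^sub>m 1 n) (N * - ?v + ?v * ?s a)
      (?w * 1\<^sub>m n + 1\<^sub>m 1 * 0\<^sub>m 1 n) (?w * - ?v + 1\<^sub>m 1 * ?s a)"
    by (rule mult_four_block_mat) (use carr N in auto)
  also have "N * 1\<^sub>m n + ?v * 0\<^sub>m 1 n = N" using N by auto
  also have "N * - ?v + ?v * ?s a = 0\<^sub>m n 1"
  proof (rule eq_matI)
    fix i j assume "i < dim_row (0\<^sub>m n 1 :: 'a mat)" "j < dim_col (0\<^sub>m n 1 :: 'a mat)"
    then have ij: "i < n" "j = 0" by auto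
    have "(N *\<^sub>v v) $ i = a * v $ i" using eig ij v by simp
    then have "(\<Sum>k = 0..<n. N $$ (i, k) * v $ k) = a * v $ i"
      using ij v N by (auto simp: scalar_prod_def)
    then show "(N * - ?v + ?v * ?s a) $$ (i, j) = (0\<^sub>m n 1 :: 'a mat) $$ (i, j)"
      using ij N by (auto simp: scalar_prod_def sum_negf)
  qed (use N in auto)
  also have "?w * 1\<^sub>m n + 1\<^sub>m 1 * 0\<^sub>m 1 n = ?w" by auto
  also have "?w * - ?v + 1\<^sub>m 1 * ?s a = ?s (a - w \<bullet> v)"
    using v w by (auto simp: scalar_prod_def sum_negf)
  finally have "det ?M * det (four_block_mat (1\<^sub>m n) (- ?v) (0\<^sub>m 1 n) (?s a)) =
      det (four_block_mat N (0\<^sub>m n 1) ?w (?s (a - w \<bullet> v)))"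
    using det_mult[of ?M "n + 1" "four_block_mat (1\<^sub>m n) (- ?v) (0\<^sub>m 1 n) (?s a)"] carr N
    by (metis four_block_carrier_mat one_carrier_mat)
  also have "det (four_block_mat (1\<^sub>m n) (- ?v) (0\<^sub>m 1 n) (?s a)) = a"
    using carr by (subst det_four_block_mat_lower_left_zero[where n = n and m = 1])
      (auto simp: det_single)
  also have "det (four_block_mat N (0\<^sub>m n 1) ?w (?s (a - w \<bullet> v))) = det N * (a - w \<bullet> v)"
    using carr N by (subst det_four_block_mat_upper_right_zero[where n = n and m = 1])
      (auto simp: det_single)
  finally show ?thesis unfolding 1 .
qed

text \<open>At each point x, \<open>det_rank_one_update\<close> applies to N = x - A, which has the
  eigenvector f_m for x - a, and to w = c_m times the conjugate of f_m, for which the product of w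
  and f_m is c_m. Two complex polynomials that agree at every point are equal. The linear factors
  stay multiplied out so that no division occurs.\<close>

lemma char_poly_deflate_single:
  assumes A: "A \<in> carrier_mat n n" and v: "f m \<in> carrier_vec n" and nrm: "f m \<bullet>c f m = 1"
    and eig: "A *\<^sub>v f m = a \<cdot>\<^sub>v f m"
  shows "char_poly (deflate A {m} c f) * [:- a, 1:] = char_poly A * [:- (a + c m), 1:]"
proof (rule poly_ext)
  fix x
  let ?N = "- char_matrix A x" and ?w = "c m \<cdot>\<^sub>v conjugate (f m)"
  have N: "?N \<in> carrier_mat n n" using A by simp
  have w: "?w \<in> carrier_vec n" using v by simp
  have eq: "- char_matrix (deflate A {m} c f) x = ?N - mat n n (\<lambda>(i, j). f m $ i * ?w $ j)"
    using A v by (auto simp: char_matrix_def deflate_def)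
  have Nv: "?N *\<^sub>v f m = (x - a) \<cdot>\<^sub>v f m"
  proof (rule eq_vecI)
    fix i assume "i < dim_vec ((x - a) \<cdot>\<^sub>v f m)"
    with v have i: "i < n" by simp
    have "(\<Sum>j<n. A $$ (i, j) * f m $ j) = a * f m $ i"
      using arg_cong[OF eig, of "\<lambda>u. u $ i"] mult_mat_vec_conv_sum[OF A v i] i v by simp
    moreover have "?N $$ (i, j) * f m $ j = (if i = j then x * f m $ j else 0) - A $$ (i, j) * f m $ j"
      if "j < n" for j
      using A i that by (auto simp: char_matrix_def left_diff_distrib)
    ultimately have "(?N *\<^sub>v f m) $ i = x * f m $ i - a * f m $ i"
      using i by (subst mult_mat_vec_conv_sum[OF N v i]) (simp add: sum_subtractf)
    then show "(?N *\<^sub>v f m) $ i = ((x - a) \<cdot>\<^sub>v f m) $ i"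
      using i v by (simp add: left_diff_distrib)
  qed (use A v in \<open>auto simp: char_matrix_def\<close>)
  have wv: "?w \<bullet> f m = c m"
  proof -
    have "?w \<bullet> f m = f m \<bullet> ?w" using v w by (rule_tac comm_scalar_prod[of _ n])
    also have "\<dots> = c m * (f m \<bullet>c f m)" using v by simp
    finally show ?thesis using nrm by simp
  qed
  have "det (- char_matrix (deflate A {m} c f) x) * (x - a) = det ?N * (x - a - c m)"
    unfolding eq using det_rank_one_update[OF N v w Nv] wv by simp
  then show "poly (char_poly (deflate A {m} c f) * [:- a, 1:]) x =
      poly (char_poly A * [:- (a + c m), 1:]) x"
    by (simp add: char_poly_matrix[OF A] char_poly_matrix[OF deflate_carrier[OF A]] algebra_simps)
qed

lemma char_poly_nonzero: "A \<in> carrier_mat n n \<Longrightarrow> char_poly A \<noteq> 0"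
  using degree_monic_char_poly[of A n] by force

text \<open>The roots of both sides of the polynomial identity are compared. Placing the old root on
  one side and the new root on the other expresses the exchange without multiset
  subtraction.\<close>

lemma proots_char_poly_deflate_single:
  fixes A :: "complex mat"
  assumes "A \<in> carrier_mat n n" "f m \<in> carrier_vec n" "f m \<bullet>c f m = 1"
    "A *\<^sub>v f m = a \<cdot>\<^sub>v f m"
  shows "add_mset a (proots (char_poly (deflate A {m} c f))) =
    add_mset (a + c m) (proots (char_poly A))"
proof -
  have "proots (char_poly (deflate A {m} c f) * [:- a, 1:]) =
      proots (char_poly A * [:- (a + c m), 1:])"
    using char_poly_deflate_single[where f = f and m = m, OF assms] by simp
  moreover have "char_poly (deflate A {m} c f) \<noteq> 0" "char_poly A \<noteq> 0"
    by (rule char_poly_nonzero[OF deflate_carrier[OF assms(1)]], rule char_poly_nonzero[OF assms(1)])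
  moreover have "proots (p * [:- b, 1:]) = add_mset b (proots p)" if "p \<noteq> 0" for p and b :: complex
    using that by (subst proots_mult) auto
  ultimately show ?thesis by metis
qed

text \<open>The rank-one exchange is iterated over I: each further vector is still an eigenvector,
  with its original eigenvalue, of the matrix deflated so far.\<close>

lemma proots_char_poly_deflate:
  fixes A :: "complex mat"
  assumes "finite I" and A: "A \<in> carrier_mat n n" and "orthonormal_vecs n I f"
    and "\<And>k. k \<in> I \<Longrightarrow> A *\<^sub>v f k = a k \<cdot>\<^sub>v f k"
  shows "image_mset a (mset_set I) + proots (char_poly (deflate A I c f)) =
    image_mset (\<lambda>k. a k + c k) (mset_set I) + proots (char_poly A)"
  using assms(1,3,4)
proof (induction I)
  case empty
  show ?case by (simp add: deflate_empty)
next
  case (insert m I)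
  let ?B = "deflate A I c f"
  have orth: "f k \<in> carrier_vec n" "f m \<bullet>c f m = 1" "k \<in> I \<Longrightarrow> f m \<bullet>c f k = 0"
    if "k \<in> insert m I" for k
    using insert.prems(1) insert.hyps that unfolding orthonormal_vecs_def by auto
  \<comment> \<open>By orthogonality the updates along the earlier vectors vanish on f_m.\<close>
  have "?B *\<^sub>v f m = A *\<^sub>v f m + lincomb_vec n I (\<lambda>k. c k * (f m \<bullet>c f k)) f"
    using A orth by (intro deflate_mult_vec) auto
  also have "lincomb_vec n I (\<lambda>k. c k * (f m \<bullet>c f k)) f = 0\<^sub>v n"
    using orth by (intro lincomb_vec_zero) auto
  finally have "?B *\<^sub>v f m = a m \<cdot>\<^sub>v f m"
    using insert.prems(2) A orth by simp
  then have "add_mset (a m) (proots (char_poly (deflate ?B {m} c f))) =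
      add_mset (a m + c m) (proots (char_poly ?B))"
    using orth A by (intro proots_char_poly_deflate_single) auto
  moreover have "image_mset a (mset_set I) + proots (char_poly ?B) =
      image_mset (\<lambda>k. a k + c k) (mset_set I) + proots (char_poly A)"
    using insert.prems by (intro insert.IH) (auto simp: orthonormal_vecs_def)
  ultimately show ?case
    using insert.hyps unfolding deflate_insert[OF insert.hyps]
    by (simp flip: union_mset_add_mset_right)
qed

section \<open>Hermitian matrices: real eigenvalues and the Rayleigh bound\<close>

text \<open>Moving A from one side of the inner product to the other turns z into its conjugate. In
  the Rayleigh bound this makes the deflation coefficient real, so that the deflated matrix is again
  Hermitian.\<close>

lemma hermitian_eigenvalue_real:
  assumes A: "A \<in> carrier_mat n n" "hermitian_mat A" and v: "v \<in> carrier_vec n" "v \<noteq> 0\<^sub>v n"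
    and eig: "A *\<^sub>v v = z \<cdot>\<^sub>v v"
  shows "cnj z = z"
proof -
  have "z * (v \<bullet>c v) = (A *\<^sub>v v) \<bullet>c v"
    using v by (simp add: eig)
  also have "\<dots> = v \<bullet>c (A *\<^sub>v v)"
    using A v by (intro hermitian_cscalar_prod)
  also have "\<dots> = cnj z * (v \<bullet>c v)"
    using v by (simp add: eig conjugate_smult_vec)
  finally have "z * (v \<bullet>c v) = cnj z * (v \<bullet>c v)" .
  moreover have "v \<bullet>c v \<noteq> 0"
    using cscalar_prod_self_Re(2)[OF v(1)] v(2) by auto
  ultimately show ?thesis by simp
qed

text \<open>Triangularise \<open>A = P B Q\<close>.  Each application of \<open>A - t\<close> shortens the support of
  \<open>Q u\<close>, so \<open>A - t\<close> is nilpotent, and a nilpotent Hermitian matrix vanishes because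
  \<open>(A - t)\<^sup>2 u = 0\<close> forces \<open>(A - t) u = 0\<close>.\<close>

lemma hermitian_single_eigenvalue:
  assumes A: "A \<in> carrier_mat n n" "hermitian_mat A"
    and roots: "\<And>z. z \<in># proots (char_poly A) \<Longrightarrow> z = complex_of_real t"
    and u: "u \<in> carrier_vec n"
  shows "A *\<^sub>v u = complex_of_real t \<cdot>\<^sub>v u"
proof -
  let ?t = "complex_of_real t"
  obtain as where as: "char_poly A = (\<Prod>a\<leftarrow>as. [:- a, 1:])"
    using char_poly_factorized[OF A(1)] by blast
  obtain B P Q where schur: "schur_decomposition A as = (B, P, Q)"
    by (cases "schur_decomposition A as") auto
  have wit: "similar_mat_wit A B P Q" and ut: "upper_triangular B" and diag: "diag_mat B = as"
    using schur_decomposition[OF A(1) as schur] by auto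
  note carr = similar_mat_witD2[OF A(1) wit]
  have B: "B \<in> carrier_mat n n" and Q: "Q \<in> carrier_mat n n" and P: "P \<in> carrier_mat n n"
    using carr by auto
  have PQ: "P * Q = 1\<^sub>m n" and QP: "Q * P = 1\<^sub>m n" and PBQ: "A = P * B * Q"
    using carr by auto
  \<comment> \<open>The diagonal of the triangular factor lists the roots of the characteristic
    polynomial, all of which equal t.\<close>
  have diag_t: "B $$ (i, i) = ?t" if "i < n" for i
  proof -
    have "B $$ (i, i) \<in> set as"
      using that B unfolding diag[symmetric] by (auto simp: diag_mat_def)
    then have "poly (char_poly A) (B $$ (i, i)) = 0"
      by (auto simp: as poly_prod_list prod_list_zero_iff)
    then show ?thesis
      using char_poly_nonzero[OF A(1)] by (intro roots) simp
  qed
  define M where "M x = A *\<^sub>v x - ?t \<cdot>\<^sub>v x" for x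
  have M [simp]: "M x \<in> carrier_vec n" if "x \<in> carrier_vec n" for x
    using that A by (auto simp: M_def)
  have M_sym: "M x \<bullet>c y = x \<bullet>c M y" if "x \<in> carrier_vec n" "y \<in> carrier_vec n" for x y
    using that A hermitian_cscalar_prod[OF A(2,1) that]
    by (simp add: M_def minus_scalar_prod_distrib[of _ n] cscalar_prod_conv_sum[of _ n]
        algebra_simps sum_subtractf sum_distrib_left del: index_mult_mat_vec)
  have QA: "Q *\<^sub>v (A *\<^sub>v x) = B *\<^sub>v (Q *\<^sub>v x)" if x: "x \<in> carrier_vec n" for x
  proof -
    have "Q *\<^sub>v (A *\<^sub>v x) = (Q * A) *\<^sub>v x"
      using Q A x by simp
    also have "Q * A = (Q * P) * (B * Q)"
      unfolding PBQ using P B Q by (simp add: assoc_mult_mat[of _ n n _ n _ n])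
    also have "\<dots> = B * Q" using QP B Q by simp
    finally show ?thesis using B Q x by simp
  qed
  \<comment> \<open>The number m bounds the support of Q x: only the first m coordinates may be
    nonzero. The induction is on this bound.\<close>
  have "M x = 0\<^sub>v n" if "x \<in> carrier_vec n" "\<forall>i<n. m \<le> i \<longrightarrow> (Q *\<^sub>v x) $ i = 0" for m x
    using that
  proof (induction m arbitrary: x)
    case 0
    then have "Q *\<^sub>v x = 0\<^sub>v n" using Q by (intro eq_vecI) auto
    moreover have "P *\<^sub>v (Q *\<^sub>v x) = x"
      using P Q 0 by (simp flip: assoc_mult_mat_vec add: PQ)
    moreover have "P *\<^sub>v 0\<^sub>v n = 0\<^sub>v n" using P by (intro eq_vecI) auto
    ultimately have "x = 0\<^sub>v n" by simp
    then show ?case using A by (auto simp: M_def)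
  next
    case (Suc m)
    have y: "Q *\<^sub>v x \<in> carrier_vec n" using Q Suc.prems(1) by simp
    have QM: "Q *\<^sub>v M x = B *\<^sub>v (Q *\<^sub>v x) - ?t \<cdot>\<^sub>v (Q *\<^sub>v x)"
      using Suc.prems(1) A Q
      by (simp add: M_def mult_minus_distrib_mat_vec[of _ n n] QA mult_mat_vec[of _ n n])
    \<comment> \<open>In row i >= m, triangularity removes the terms with j < i and the support
      bound removes those with j > i. What remains is the diagonal term, which the subtraction of t
      cancels.\<close>
    have "(Q *\<^sub>v M x) $ i = 0" if i: "i < n" "m \<le> i" for i
    proof -
      have "(B *\<^sub>v (Q *\<^sub>v x)) $ i = (\<Sum>j<n. B $$ (i, j) * (Q *\<^sub>v x) $ j)"
        using mult_mat_vec_conv_sum[OF B y i(1)] .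
      also have "\<dots> = (\<Sum>j\<in>{i}. B $$ (i, j) * (Q *\<^sub>v x) $ j)"
      proof (rule sum.mono_neutral_right)
        show "\<forall>j\<in>{..<n} - {i}. B $$ (i, j) * (Q *\<^sub>v x) $ j = 0"
        proof
          fix j assume j: "j \<in> {..<n} - {i}"
          show "B $$ (i, j) * (Q *\<^sub>v x) $ j = 0"
          proof (cases "j < i")
            case True
            then have "B $$ (i, j) = 0" using upper_triangularD[OF ut] B i by auto
            then show ?thesis by simp
          next
            case False
            then have "(Q *\<^sub>v x) $ j = 0" using Suc.prems(2) i j by auto
            then show ?thesis by simp
          qed
        qed
      qed (use i in auto)
      finally have "(B *\<^sub>v (Q *\<^sub>v x)) $ i = ?t * (Q *\<^sub>v x) $ i"
        using diag_t[OF i(1)] by simp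
      then show ?thesis
        unfolding QM using i B Q y by simp
    qed
    then have MM: "M (M x) = 0\<^sub>v n"
      using Suc.prems(1) by (intro Suc.IH) auto
    have "M x \<bullet>c M x = x \<bullet>c M (M x)"
      using Suc.prems(1) by (intro M_sym) auto
    also have "\<dots> = 0" unfolding MM using Suc.prems(1) by simp
    finally show ?case
      using cscalar_prod_self_Re(2)[OF M[OF Suc.prems(1)]] by simp
  qed
  \<comment> \<open>For m = n the support condition is vacuous.\<close>
  from this[OF u, of n] have M0: "M u = 0\<^sub>v n" by simp
  show ?thesis
  proof (rule eq_vecI)
    fix i assume "i < dim_vec (?t \<cdot>\<^sub>v u)"
    then have i: "i < n" using u by simp
    have "M u $ i = 0" using M0 i by simp
    then show "(A *\<^sub>v u) $ i = (?t \<cdot>\<^sub>v u) $ i"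
      using i A u by (simp add: M_def)
  qed (use A u in auto)
qed

text \<open>Induction on the number of eigenvalues different from t, counted with multiplicity. If
  there are none, A acts as t. Otherwise an eigenvalue z > t with unit eigenvector v is deflated to
  t, which lowers the form at u by (z - t) |<u, v>|^2. The bound for the deflated matrix therefore
  implies the bound for A, and equality for A forces <u, v> = 0 together with equality for the
  deflated matrix.\<close>

lemma hermitian_rayleigh_bound:
  assumes "A \<in> carrier_mat n n" "hermitian_mat A"
    and "\<And>z. z \<in># proots (char_poly A) \<Longrightarrow> t \<le> Re z"
    and u: "u \<in> carrier_vec n"
  shows "t * Re (u \<bullet>c u) \<le> Re ((A *\<^sub>v u) \<bullet>c u) \<and>
    (Re ((A *\<^sub>v u) \<bullet>c u) = t * Re (u \<bullet>c u) \<longrightarrow> A *\<^sub>v u = complex_of_real t \<cdot>\<^sub>v u)"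
  using assms(1-3)
proof (induction "size {#z \<in># proots (char_poly A). z \<noteq> complex_of_real t#}" arbitrary: A rule: less_induct)
  case less
  let ?t = "complex_of_real t"
  note A = less.prems(1,2)
  show ?case
  proof (cases "\<forall>z \<in># proots (char_poly A). z = ?t")
    case True
    then have "A *\<^sub>v u = ?t \<cdot>\<^sub>v u"
      using A u by (intro hermitian_single_eigenvalue) auto
    then show ?thesis using u by simp
  next
    case False
    then obtain z where z: "z \<in># proots (char_poly A)" "z \<noteq> ?t" by blast
    then have "eigenvalue A z"
      using eigenvalue_root_char_poly[OF A(1)] char_poly_nonzero[OF A(1)] by simp
    then obtain x where x: "x \<in> carrier_vec n" "x \<noteq> 0\<^sub>v n" "A *\<^sub>v x = z \<cdot>\<^sub>v x"
      using A(1) by (auto simp: eigenvalue_def eigenvector_def)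
    define N where "N = Re (x \<bullet>c x)"
    have N: "N > 0" "x \<bullet>c x = complex_of_real N"
      using cscalar_prod_self_Re[OF x(1)] x(2) cscalar_prod_self[OF x(1)] by (auto simp: N_def less_le)
    define v where "v = complex_of_real (1 / sqrt N) \<cdot>\<^sub>v x"
    have v: "v \<in> carrier_vec n" "A *\<^sub>v v = z \<cdot>\<^sub>v v"
      using x A by (auto simp: v_def mult_mat_vec[of _ n n] smult_smult_assoc mult.commute)
    have "v \<bullet>c v = complex_of_real (1 / sqrt N * (1 / sqrt N) * N)"
    proof -
      have "v \<bullet>c v = complex_of_real (1 / sqrt N) * cnj (complex_of_real (1 / sqrt N)) * (x \<bullet>c x)"
        using x by (simp add: v_def conjugate_smult_vec)
      then show ?thesis by (simp only: N(2) complex_cnj_complex_of_real of_real_mult)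
    qed
    also have "1 / sqrt N * (1 / sqrt N) * N = 1"
      using N by (simp add: field_simps flip: power2_eq_square)
    finally have v1: "v \<bullet>c v = 1" by simp
    have "cnj z = z" using hermitian_eigenvalue_real[OF A x] .
    then have z_real: "z = complex_of_real (Re z)" by (simp add: complex_eq_iff)
    have "Re z \<noteq> t" using z_real z(2) by auto
    with less.prems(3)[OF z(1)] have z_gt: "t < Re z" by simp
    \<comment> \<open>A one-element index set with a constant family: the coefficient t - z moves
      the eigenvalue z to t.\<close>
    let ?C = "deflate A {0} (\<lambda>_. ?t - z) (\<lambda>_. v)"
    have C: "?C \<in> carrier_mat n n" "hermitian_mat ?C"
      using A \<open>cnj z = z\<close> by (auto intro!: hermitian_deflate Reals_diff simp: Reals_cnj_iff)
    have "add_mset z (proots (char_poly ?C)) = add_mset (z + (?t - z)) (proots (char_poly A))"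
      using A v v1 by (intro proots_char_poly_deflate_single[where f = "\<lambda>_. v"]) auto
    then have roots: "add_mset z (proots (char_poly ?C)) = add_mset ?t (proots (char_poly A))"
      by simp
    have IH: "t * Re (u \<bullet>c u) \<le> Re ((?C *\<^sub>v u) \<bullet>c u) \<and>
      (Re ((?C *\<^sub>v u) \<bullet>c u) = t * Re (u \<bullet>c u) \<longrightarrow> ?C *\<^sub>v u = ?t \<cdot>\<^sub>v u)"
    proof (rule less.hyps[OF _ C])
      \<comment> \<open>Discarding all copies of t from the root exchange leaves z as the only
        difference, so the measure drops by one.\<close>
      have "filter_mset (\<lambda>z. z \<noteq> ?t) (add_mset z (proots (char_poly ?C))) =
          filter_mset (\<lambda>z. z \<noteq> ?t) (proots (char_poly A))"
        unfolding roots by simp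
      then have "filter_mset (\<lambda>z. z \<noteq> ?t) (proots (char_poly A)) =
          add_mset z (filter_mset (\<lambda>z. z \<noteq> ?t) (proots (char_poly ?C)))"
        using z(2) by simp
      then show "size {#z \<in># proots (char_poly ?C). z \<noteq> ?t#} <
          size {#z \<in># proots (char_poly A). z \<noteq> ?t#}"
        by simp
    next
      fix y assume "y \<in># proots (char_poly ?C)"
      then have "y \<in># add_mset ?t (proots (char_poly A))"
        unfolding roots[symmetric] by simp
      then show "t \<le> Re y" using less.prems(3) by auto
    qed
    define c where "c = u \<bullet>c v"
    have Cu: "?C *\<^sub>v u = A *\<^sub>v u + ((?t - z) * c) \<cdot>\<^sub>v v"
    proof -
      have "?C *\<^sub>v u = A *\<^sub>v u + lincomb_vec n {0} (\<lambda>k. (?t - z) * (u \<bullet>c v)) (\<lambda>_. v)"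
        using A v u by (intro deflate_mult_vec) auto
      also have "lincomb_vec n {0} (\<lambda>k. (?t - z) * (u \<bullet>c v)) (\<lambda>_. v) = ((?t - z) * c) \<cdot>\<^sub>v v"
        using v unfolding c_def by (subst lincomb_vec_single[where m = 0]) auto
      finally show ?thesis .
    qed
    have "(?C *\<^sub>v u) \<bullet>c u = (A *\<^sub>v u) \<bullet>c u + (?t - z) * c * (v \<bullet>c u)"
      unfolding Cu using A v u by (simp add: add_scalar_prod_distrib[of _ n])
    also have "(?t - z) * c * (v \<bullet>c u) = (?t - z) * (c * cnj c)"
      using cscalar_prod_swap[OF u v(1)] by (simp add: c_def)
    also have "\<dots> = complex_of_real ((t - Re z) * (cmod c)\<^sup>2)"
    proof -
      have "c * cnj c = (complex_of_real (cmod c))\<^sup>2"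
        using complex_norm_square[of c] by simp
      then show ?thesis by (subst z_real) simp
    qed
    finally have "Re ((?C *\<^sub>v u) \<bullet>c u) = Re ((A *\<^sub>v u) \<bullet>c u) + (t - Re z) * (cmod c)\<^sup>2"
      by (simp only: plus_complex.sel Re_complex_of_real)
    then have Re_C: "Re ((?C *\<^sub>v u) \<bullet>c u) = Re ((A *\<^sub>v u) \<bullet>c u) - (Re z - t) * (cmod c)\<^sup>2"
      by (simp add: algebra_simps)
    have nonneg: "0 \<le> (Re z - t) * (cmod c)\<^sup>2" using z_gt by simp
    show ?thesis
    proof (intro conjI impI)
      show "t * Re (u \<bullet>c u) \<le> Re ((A *\<^sub>v u) \<bullet>c u)"
        using IH Re_C nonneg by linarith
      assume "Re ((A *\<^sub>v u) \<bullet>c u) = t * Re (u \<bullet>c u)"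
      \<comment> \<open>The induction hypothesis bounds the deflated form from below and the gap
        term is nonnegative, so equality in their sum makes both tight.\<close>
      then have "(Re z - t) * (cmod c)\<^sup>2 = 0" and "Re ((?C *\<^sub>v u) \<bullet>c u) = t * Re (u \<bullet>c u)"
        using IH Re_C nonneg by linarith+
      then have "c = 0" and "?C *\<^sub>v u = ?t \<cdot>\<^sub>v u" using z_gt IH by auto
      moreover have "A *\<^sub>v u + 0 \<cdot>\<^sub>v v = A *\<^sub>v u"
        using A v by (intro eq_vecI) auto
      ultimately show "A *\<^sub>v u = ?t \<cdot>\<^sub>v u" using Cu by simp
    qed
  qed
qed

section \<open>Ordered eigenvalues\<close>

text \<open>If the entry at position k exceeds t, so do all later ones, and only the k entries
  before it can be at most t.\<close>

lemma sorted_nth_le_of_count: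
  fixes xs :: "real list"
  assumes "sorted xs" "k < size {#x \<in># mset xs. x \<le> t#}"
  shows "xs ! k \<le> t"
proof (rule ccontr)
  assume gt: "\<not> xs ! k \<le> t"
  have "filter (\<lambda>x. x \<le> t) (drop k xs) = []"
  proof (rule filter_False, rule ballI)
    fix x assume "x \<in> set (drop k xs)"
    then obtain i where "i < length (drop k xs)" "x = drop k xs ! i"
      by (metis in_set_conv_nth)
    then have "x = xs ! (k + i)" "k + i < length xs" by auto
    with assms(1) have "xs ! k \<le> x" by (simp add: sorted_nth_mono)
    with gt show "\<not> x \<le> t" by simp
  qed
  then have "filter (\<lambda>x. x \<le> t) xs = filter (\<lambda>x. x \<le> t) (take k xs)"
    by (metis append_Nil2 append_take_drop_id filter_append)
  then have "size {#x \<in># mset xs. x \<le> t#} \<le> length (take k xs)"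
    by (metis length_filter_le mset_filter size_mset)
  with assms(2) show False by simp
qed

lemma sorted_eigenvalue_list [simp]: "sorted (eigenvalue_list A)"
  and mset_eigenvalue_list [simp]: "mset (eigenvalue_list A) = image_mset Re (proots (char_poly A))"
  by (simp_all add: eigenvalue_list_def)

text \<open>A complex polynomial of degree n has n roots with multiplicity. Hence
  \<open>kth_eigenvalue A k\<close> reads a genuine list entry for 1 <= k <= n.\<close>

lemma length_eigenvalue_list:
  assumes "A \<in> carrier_mat n n"
  shows "length (eigenvalue_list A) = n"
proof -
  have "length (eigenvalue_list A) = size (proots (char_poly A))"
    by (metis mset_eigenvalue_list size_image_mset size_mset)
  then show ?thesis
    using degree_monic_char_poly[OF assms] by (simp add: size_proots_complex)
qed

text \<open>Moving the eigenvalues \<open>a k\<close> to a common value that none of them equals shows that they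
  occur, with multiplicity, among the roots of the characteristic polynomial.\<close>

lemma kth_eigenvalue_le:
  assumes A: "A \<in> carrier_mat n n" and f: "orthonormal_vecs n {1..l} f"
    and eig: "\<And>k. k \<in> {1..l} \<Longrightarrow> A *\<^sub>v f k = complex_of_real (a k) \<cdot>\<^sub>v f k"
    and le: "\<And>k. k \<in> {1..l} \<Longrightarrow> a k \<le> t"
    and k: "k \<in> {1..l}"
  shows "kth_eigenvalue A k \<le> t"
proof -
  \<comment> \<open>Since every a_k is at most t, the value t + 1 differs from all of them.\<close>
  let ?I = "mset_set {1..l}" and ?s = "complex_of_real (t + 1)"
  let ?a = "\<lambda>k. complex_of_real (a k)"
  have roots: "image_mset ?a ?I + proots (char_poly (deflate A {1..l} (\<lambda>k. ?s - ?a k) f)) =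
      image_mset (\<lambda>k. ?a k + (?s - ?a k)) ?I + proots (char_poly A)"
    using A f eig by (intro proots_char_poly_deflate) auto
  \<comment> \<open>Filtering out t + 1 removes the shifted copies on the right and keeps every a_k
    on the left, which leaves an inclusion of the a_k in the roots for A.\<close>
  have "filter_mset (\<lambda>z. z \<noteq> ?s) (image_mset ?a ?I) \<subseteq>#
      filter_mset (\<lambda>z. z \<noteq> ?s) (image_mset (\<lambda>k. ?a k + (?s - ?a k)) ?I + proots (char_poly A))"
    unfolding roots[symmetric] by (rule multiset_filter_mono[OF mset_subset_eq_add_left])
  also have "filter_mset (\<lambda>z. z \<noteq> ?s) (image_mset (\<lambda>k. ?a k + (?s - ?a k)) ?I + proots (char_poly A)) =
      filter_mset (\<lambda>z. z \<noteq> ?s) (proots (char_poly A))"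
    by (simp add: filter_mset_image_mset)
  also have "\<dots> \<subseteq># proots (char_poly A)" by simp
  also have "filter_mset (\<lambda>z. z \<noteq> ?s) (image_mset ?a ?I) = image_mset ?a ?I"
  proof -
    have "a k \<noteq> t + 1" if "k \<in> {1..l}" for k using le[OF that] by linarith
    then have "?a k \<noteq> ?s" if "k \<in> {1..l}" for k using that of_real_eq_iff by blast
    then show ?thesis by (subst filter_mset_eq_conv) auto
  qed
  finally have "image_mset Re (image_mset ?a ?I) \<subseteq># mset (eigenvalue_list A)"
    by (simp only: mset_eigenvalue_list image_mset_subseteq_mono)
  then have "image_mset a ?I \<subseteq># mset (eigenvalue_list A)"
    by (simp add: multiset.map_comp o_def)
  then have "filter_mset (\<lambda>x. x \<le> t) (image_mset a ?I) \<subseteq># {#x \<in># mset (eigenvalue_list A). x \<le> t#}"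
    by (rule multiset_filter_mono)
  moreover have "filter_mset (\<lambda>x. x \<le> t) (image_mset a ?I) = image_mset a ?I"
    using le by (subst filter_mset_eq_conv) auto
  ultimately have "l \<le> size {#x \<in># mset (eigenvalue_list A). x \<le> t#}"
    using size_mset_mono by fastforce
  \<comment> \<open>The list position is k - 1, which is smaller than l.\<close>
  with k show ?thesis
    unfolding kth_eigenvalue_def by (intro sorted_nth_le_of_count) auto
qed

lemma kth_eigenvalue_mono:
  assumes "A \<in> carrier_mat n n" "1 \<le> j" "j \<le> k" "k \<le> n"
  shows "kth_eigenvalue A j \<le> kth_eigenvalue A k"
  using assms length_eigenvalue_list[OF assms(1)]
  by (auto simp: kth_eigenvalue_def intro!: sorted_nth_mono)

text \<open>Moving \<open>\<lambda>\<^sub>1, \<dots>, \<lambda>\<^sub>l\<close> up to \<open>\<lambda>\<^sub>l\<close> leaves a matrix that has no eigenvalue below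
  \<open>\<lambda>\<^sub>l\<close> and acts like \<open>A\<close> on the orthogonal complement of the eigenvectors.\<close>

lemma lowest_eigenvectors_complement:
  assumes A: "A \<in> carrier_mat n n" "hermitian_mat A" and v: "lowest_eigenvectors A l v"
    and l: "1 \<le> l" "l \<le> n"
    and u: "u \<in> carrier_vec n" "\<And>k. k \<in> {1..l} \<Longrightarrow> u \<bullet>c v k = 0"
  defines "t \<equiv> kth_eigenvalue A l"
  shows "t * Re (u \<bullet>c u) \<le> Re ((A *\<^sub>v u) \<bullet>c u) \<and>
    (Re ((A *\<^sub>v u) \<bullet>c u) = t * Re (u \<bullet>c u) \<longrightarrow> A *\<^sub>v u = complex_of_real t \<cdot>\<^sub>v u)"
proof -
  let ?I = "mset_set {1..l}" and ?L = "eigenvalue_list A"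
  let ?a = "\<lambda>k. complex_of_real (kth_eigenvalue A k)" and ?t = "complex_of_real t"
  let ?C = "deflate A {1..l} (\<lambda>k. ?t - ?a k) v"
  have orth: "orthonormal_vecs n {1..l} v"
    using v A by (auto simp: lowest_eigenvectors_def)
  have eig: "A *\<^sub>v v k = ?a k \<cdot>\<^sub>v v k" "v k \<in> carrier_vec n" if "k \<in> {1..l}" for k
    using v A that by (auto simp: lowest_eigenvectors_def eigenvector_def)
  have "image_mset ?a ?I + proots (char_poly ?C) =
      image_mset (\<lambda>k. ?a k + (?t - ?a k)) ?I + proots (char_poly A)"
    using A orth eig by (intro proots_char_poly_deflate) auto
  then have "image_mset Re (image_mset ?a ?I + proots (char_poly ?C)) =
      image_mset Re (image_mset (\<lambda>k. ?t) ?I + proots (char_poly A))"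
    by simp
  then have eq: "image_mset (kth_eigenvalue A) ?I + image_mset Re (proots (char_poly ?C)) =
      image_mset (\<lambda>k. t) ?I + mset ?L"
    by (simp add: multiset.map_comp o_def)
  have len: "length ?L = n" by (rule length_eigenvalue_list[OF A(1)])
  \<comment> \<open>The indices 1 to l correspond to the list positions 0 to l - 1, so the l lowest
    eigenvalues form the initial segment \<open>take l ?L\<close>.\<close>
  have "image_mset (kth_eigenvalue A) ?I = mset (map (kth_eigenvalue A) [1..<Suc l])"
    by (simp add: atLeastLessThanSuc_atLeastAtMost del: upt_Suc)
  also have "map (kth_eigenvalue A) [1..<Suc l] = take l ?L"
    using l len by (intro nth_equalityI) (auto simp: kth_eigenvalue_def simp del: upt_Suc)
  finally have split: "mset ?L = image_mset (kth_eigenvalue A) ?I + mset (drop l ?L)"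
    using mset_append[of "take l ?L" "drop l ?L"] by (simp del: mset_eigenvalue_list)
  \<comment> \<open>Cancelling the l lowest eigenvalues leaves l copies of t and the tail of the
    sorted list, none of whose entries is below t.\<close>
  have roots: "image_mset Re (proots (char_poly ?C)) = image_mset (\<lambda>k. t) ?I + mset (drop l ?L)"
  proof -
    have "image_mset (kth_eigenvalue A) ?I + image_mset Re (proots (char_poly ?C)) =
        image_mset (kth_eigenvalue A) ?I + (image_mset (\<lambda>k. t) ?I + mset (drop l ?L))"
      unfolding eq using split by (simp add: ac_simps)
    then show ?thesis by (rule add_left_imp_eq)
  qed
  have "t \<le> Re z" if "z \<in># proots (char_poly ?C)" for z
  proof -
    have "Re z \<in># image_mset (\<lambda>k. t) ?I + mset (drop l ?L)"
      using that unfolding roots[symmetric] by simp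
    then consider "Re z = t" | "Re z \<in> set (drop l ?L)" by auto
    then show ?thesis
    proof cases
      case 2
      then obtain i where "i < length (drop l ?L)" "Re z = drop l ?L ! i"
        by (metis in_set_conv_nth)
      then have "Re z = ?L ! (l + i)" "l + i < length ?L" using l len by auto
      then show ?thesis
        unfolding t_def kth_eigenvalue_def by (auto intro!: sorted_nth_mono)
    qed simp
  qed
  moreover have "hermitian_mat ?C"
    using A by (intro hermitian_deflate) auto
  moreover have "?C *\<^sub>v u = A *\<^sub>v u"
  proof -
    have "?C *\<^sub>v u = A *\<^sub>v u + lincomb_vec n {1..l} (\<lambda>k. (?t - ?a k) * (u \<bullet>c v k)) v"
      using A u eig by (intro deflate_mult_vec) auto
    also have "lincomb_vec n {1..l} (\<lambda>k. (?t - ?a k) * (u \<bullet>c v k)) v = 0\<^sub>v n"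
      using u(2) by (intro lincomb_vec_zero) simp
    finally show ?thesis using mult_mat_vec_carrier[OF A(1) u(1)] by simp
  qed
  ultimately show ?thesis
    using hermitian_rayleigh_bound[of ?C n t u] A u by simp
qed

section \<open>Compression to a subspace containing the lowest eigenvectors\<close>

lemma cscalar_prod_mat_adjoint':
  fixes A :: "complex mat"
  assumes A: "A \<in> carrier_mat nr nc" and x: "x \<in> carrier_vec nc" and y: "y \<in> carrier_vec nr"
  shows "y \<bullet>c (A *\<^sub>v x) = (mat_adjoint A *\<^sub>v y) \<bullet>c x"
proof -
  have "y \<bullet>c (A *\<^sub>v x) = cnj ((A *\<^sub>v x) \<bullet>c y)"
    using A x y by (intro cscalar_prod_swap[of _ nr]) auto
  also have "\<dots> = cnj (x \<bullet>c (mat_adjoint A *\<^sub>v y))"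
    using cscalar_prod_mat_adjoint[OF A x y] by simp
  also have "\<dots> = (mat_adjoint A *\<^sub>v y) \<bullet>c x"
    using A x y by (intro cscalar_prod_swap[symmetric, of _ nc]) auto
  finally show ?thesis .
qed

lemma mat_adjoint_mult_self_orthonormal:
  assumes "orthonormal_vecs (dim_row V) {..<dim_col V} (col V)"
  shows "mat_adjoint V * V = 1\<^sub>m (dim_col V)"
proof (rule eq_matI)
  fix i j assume "i < dim_row (1\<^sub>m (dim_col V) :: complex mat)" "j < dim_col (1\<^sub>m (dim_col V) :: complex mat)"
  then have ij: "i < dim_col V" "j < dim_col V" by auto
  have "(mat_adjoint V * V) $$ (i, j) = col V j \<bullet>c col V i"
    using ij by (auto simp: scalar_prod_def mat_adjoint_index mult.commute intro!: sum.cong)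
  also have "\<dots> = 1\<^sub>m (dim_col V) $$ (i, j)"
    using assms ij by (auto simp: orthonormal_vecs_def)
  finally show "(mat_adjoint V * V) $$ (i, j) = 1\<^sub>m (dim_col V) $$ (i, j)" .
qed auto

text \<open>The situation at a single parameter point. The vectors x_k are the coordinates of the
  v_k with respect to the columns of V; they encode that the range of V contains the l lowest
  eigenvectors of A.\<close>

locale galerkin =
  fixes n l d :: nat and A V :: "complex mat" and v x :: "nat \<Rightarrow> complex vec"
  assumes A: "A \<in> carrier_mat n n" "hermitian_mat A"
    and lowest: "lowest_eigenvectors A l v" and l: "1 \<le> l" "l \<le> n"
    and V: "V \<in> carrier_mat n d" "mat_adjoint V * V = 1\<^sub>m d"
    and x: "\<And>k. k \<in> {1..l} \<Longrightarrow> x k \<in> carrier_vec d" "\<And>k. k \<in> {1..l} \<Longrightarrow> V *\<^sub>v x k = v k"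
begin

abbreviation "B \<equiv> mat_adjoint V * A * V"

lemma B_carrier [simp]: "B \<in> carrier_mat d d"
  using A V by (auto intro!: mult_carrier_mat)

lemma B_mult: "y \<in> carrier_vec d \<Longrightarrow> B *\<^sub>v y = mat_adjoint V *\<^sub>v (A *\<^sub>v (V *\<^sub>v y))"
  using assoc_mult_mat_vec[of "mat_adjoint V * A" d n V d y]
    assoc_mult_mat_vec[of "mat_adjoint V" d n A n "V *\<^sub>v y"] A V
  by (metis mat_adjoint_carrier mult_carrier_mat mult_mat_vec_carrier)

lemma adjoint_cancel: "y \<in> carrier_vec d \<Longrightarrow> mat_adjoint V *\<^sub>v (V *\<^sub>v y) = y"
  using V by (simp flip: assoc_mult_mat_vec[of _ d n _ d])

lemma isometry: "y \<in> carrier_vec d \<Longrightarrow> z \<in> carrier_vec d \<Longrightarrow> (V *\<^sub>v y) \<bullet>c (V *\<^sub>v z) = y \<bullet>c z"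
  using V by (subst cscalar_prod_mat_adjoint'[of V n d]) (auto simp: adjoint_cancel)

lemma v_simps: "k \<in> {1..l} \<Longrightarrow> v k \<in> carrier_vec n"
  "k \<in> {1..l} \<Longrightarrow> A *\<^sub>v v k = complex_of_real (kth_eigenvalue A k) \<cdot>\<^sub>v v k"
  "k \<in> {1..l} \<Longrightarrow> m \<in> {1..l} \<Longrightarrow> v k \<bullet>c v m = (if k = m then 1 else 0)"
  using lowest A by (auto simp: lowest_eigenvectors_def eigenvector_def orthonormal_vecs_def)

text \<open>Because V is an isometry, the x_k are orthonormal, and B x_k = V^* A v_k is the k-th
  eigenvalue of A times x_k. Thus B has l eigenvalues, with multiplicity, that do not exceed the
  l-th eigenvalue of A.\<close>

lemma kth_eigenvalue_B_le:
  assumes "k \<in> {1..l}"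
  shows "kth_eigenvalue B k \<le> kth_eigenvalue A l"
proof (rule kth_eigenvalue_le[OF B_carrier, of l x "kth_eigenvalue A"])
  have "x k \<bullet>c x m = (if k = m then 1 else 0)" if "k \<in> {1..l}" "m \<in> {1..l}" for k m
    using isometry[OF x(1)[OF that(1)] x(1)[OF that(2)]] x(2) that v_simps(3) by simp
  then show "orthonormal_vecs d {1..l} x"
    using x(1) by (auto simp: orthonormal_vecs_def)
  fix k assume k: "k \<in> {1..l}"
  show "kth_eigenvalue A k \<le> kth_eigenvalue A l"
    using k l by (intro kth_eigenvalue_mono[OF A(1)]) auto
  have "B *\<^sub>v x k = mat_adjoint V *\<^sub>v (complex_of_real (kth_eigenvalue A k) \<cdot>\<^sub>v (V *\<^sub>v x k))"
    using x k v_simps(2) by (simp add: B_mult)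
  also have "\<dots> = complex_of_real (kth_eigenvalue A k) \<cdot>\<^sub>v (mat_adjoint V *\<^sub>v (V *\<^sub>v x k))"
    using V x(1)[OF k] by (intro mult_mat_vec[of _ d n]) auto
  finally show "B *\<^sub>v x k = complex_of_real (kth_eigenvalue A k) \<cdot>\<^sub>v x k"
    using adjoint_cancel x(1)[OF k] by simp
qed fact

lemma lifted_eigenvector:
  assumes w: "w \<in> carrier_vec d" "B *\<^sub>v w = complex_of_real s \<cdot>\<^sub>v w"
    and le: "s \<le> kth_eigenvalue A l"
  shows "A *\<^sub>v (V *\<^sub>v w) = complex_of_real s \<cdot>\<^sub>v (V *\<^sub>v w)"
proof -
  let ?I = "{1..l}" and ?s = "complex_of_real s" and ?t = "kth_eigenvalue A l"
  let ?a = "\<lambda>k. complex_of_real (kth_eigenvalue A k)"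
  define u where "u = V *\<^sub>v w"
  have u: "u \<in> carrier_vec n" using V w by (simp add: u_def)
  \<comment> \<open>Galerkin orthogonality: A u - s u is orthogonal to the range of V.\<close>
  have ortho: "(A *\<^sub>v u) \<bullet>c (V *\<^sub>v y) = ?s * (u \<bullet>c (V *\<^sub>v y))" if y: "y \<in> carrier_vec d" for y
  proof -
    have "(A *\<^sub>v u) \<bullet>c (V *\<^sub>v y) = (B *\<^sub>v w) \<bullet>c y"
      unfolding B_mult[OF w(1)] using A u V y by (subst cscalar_prod_mat_adjoint'[of V n d]) (auto simp: u_def)
    also have "\<dots> = ?s * (w \<bullet>c y)" using w y by simp
    finally show ?thesis using isometry[OF w(1) y] by (simp add: u_def)
  qed
  define c where "c k = u \<bullet>c v k" for k
  \<comment> \<open>Testing with v_k = V x_k shows that c_k vanishes unless the k-th eigenvalue of A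
    equals s. Hence the component p below satisfies A p = s p.\<close>
  have c_cases: "c k * ?a k = ?s * c k" if k: "k \<in> ?I" for k
  proof -
    have "(A *\<^sub>v u) \<bullet>c v k = u \<bullet>c (A *\<^sub>v v k)"
      using A u v_simps(1)[OF k] by (intro hermitian_cscalar_prod)
    also have "\<dots> = ?a k * c k"
      using u v_simps[OF k] by (simp add: conjugate_smult_vec c_def)
    finally show ?thesis
      using ortho[OF x(1)[OF k]] x(2)[OF k] by (simp add: c_def mult.commute)
  qed
  define p where "p = lincomb_vec n ?I c v"
  define q where "q = u - p"
  have p: "p \<in> carrier_vec n" and q: "q \<in> carrier_vec n" using u by (auto simp: p_def q_def)
  have Ap: "A *\<^sub>v p = ?s \<cdot>\<^sub>v p"
  proof -
    have "A *\<^sub>v p = lincomb_vec n ?I c (\<lambda>k. A *\<^sub>v v k)"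
      unfolding p_def using A v_simps by (intro mult_mat_lincomb_vec) auto
    also have "\<dots> = lincomb_vec n ?I (\<lambda>k. c k * ?a k) v"
      using v_simps by (intro lincomb_vec_eigen) auto
    also have "\<dots> = lincomb_vec n ?I (\<lambda>k. ?s * c k) v"
      using c_cases by (intro lincomb_vec_cong)
    finally show ?thesis by (simp add: p_def smult_lincomb_vec)
  qed
  have Aq: "A *\<^sub>v q = A *\<^sub>v u - ?s \<cdot>\<^sub>v p"
    unfolding q_def using A u p by (simp add: mult_minus_distrib_mat_vec[of _ n n] Ap)
  have q_perp: "q \<bullet>c v k = 0" if k: "k \<in> ?I" for k
  proof -
    have "p \<bullet>c v k = (\<Sum>m\<in>?I. c m * (v m \<bullet>c v k))"
      unfolding p_def using v_simps(1) k by (intro lincomb_vec_cscalar_prod) auto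
    also have "\<dots> = (\<Sum>m\<in>?I. if m = k then c m else 0)"
      using v_simps(3) k by (intro sum.cong) auto
    also have "\<dots> = c k" using k by simp
    finally show ?thesis
      using u p v_simps(1)[OF k] by (simp add: q_def minus_scalar_prod_distrib[of _ n] c_def)
  qed
  \<comment> \<open>These are the coordinates of q: both u and p lie in the range of V, so q is an
    admissible test vector in \<open>ortho\<close>.\<close>
  define y where "y = w - lincomb_vec d ?I c x"
  have y: "y \<in> carrier_vec d" using w by (simp add: y_def)
  have "V *\<^sub>v lincomb_vec d ?I c x = lincomb_vec n ?I c (\<lambda>k. V *\<^sub>v x k)"
    using V x by (intro mult_mat_lincomb_vec) auto
  also have "\<dots> = p"
    using x(2) by (auto simp: p_def lincomb_vec_def)
  finally have Vy: "V *\<^sub>v y = q"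
    using V w by (simp add: y_def q_def u_def mult_minus_distrib_mat_vec[of _ n d])
  have "(A *\<^sub>v q) \<bullet>c q = (A *\<^sub>v u) \<bullet>c q - ?s * (p \<bullet>c q)"
    unfolding Aq using A u p q by (simp add: minus_scalar_prod_distrib[of _ n])
  also have "(A *\<^sub>v u) \<bullet>c q = ?s * (u \<bullet>c q)"
    using ortho[OF y] by (simp add: Vy)
  also have "?s * (u \<bullet>c q) - ?s * (p \<bullet>c q) = ?s * (q \<bullet>c q)"
    using u p q by (simp add: q_def minus_scalar_prod_distrib[of u n p "conjugate (u - p)"] right_diff_distrib)
  finally have rayleigh: "Re ((A *\<^sub>v q) \<bullet>c q) = s * Re (q \<bullet>c q)" by simp
  note bound = lowest_eigenvectors_complement[OF A lowest l q q_perp]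
  have "A *\<^sub>v q = ?s \<cdot>\<^sub>v q"
  proof (cases "q = 0\<^sub>v n")
    case True
    then show ?thesis using A by (auto intro!: eq_vecI)
  next
    case False
    then have pos: "0 < Re (q \<bullet>c q)"
      using cscalar_prod_self_Re[OF q] by (simp add: less_le)
    \<comment> \<open>The Rayleigh bound gives t <= s on a nonzero q, while s <= t by assumption.
      This is the equality case, in which q is an eigenvector.\<close>
    have "?t * Re (q \<bullet>c q) \<le> s * Re (q \<bullet>c q)"
      using bound rayleigh by simp
    with pos le have "?t = s" by simp
    then show ?thesis using bound rayleigh by simp
  qed
  then have "A *\<^sub>v u - ?s \<cdot>\<^sub>v p = ?s \<cdot>\<^sub>v u - ?s \<cdot>\<^sub>v p"
    unfolding Aq unfolding q_def using u p by (intro eq_vecI) (auto simp: right_diff_distrib)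
  then have Au: "(A *\<^sub>v u - ?s \<cdot>\<^sub>v p) $ i = (?s \<cdot>\<^sub>v u - ?s \<cdot>\<^sub>v p) $ i" for i by simp
  have "A *\<^sub>v u = ?s \<cdot>\<^sub>v u"
  proof (rule eq_vecI)
    fix i assume "i < dim_vec (?s \<cdot>\<^sub>v u)"
    then show "(A *\<^sub>v u) $ i = (?s \<cdot>\<^sub>v u) $ i" using Au[of i] A u p by auto
  qed (use A u in auto)
  then show ?thesis by (simp add: u_def)
qed

end

section \<open>The residual of a matrix of eigenvectors\<close>

lemma spectral_norm_zero: "spectral_norm (0\<^sub>m m k) = 0"
proof -
  have zero: "euclid_norm (0\<^sub>v i) = 0" for i by (simp add: euclid_norm_def)
  have "{euclid_norm (0\<^sub>m m k *\<^sub>v x) | x. x \<in> carrier_vec k \<and> euclid_norm x \<le> 1} = {0}"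
  proof (intro equalityI subsetI)
    \<comment> \<open>The zero vector is a witness that the supremum is taken over a nonempty
      set.\<close>
    fix s :: real assume "s \<in> {0}"
    moreover have "(0\<^sub>m m k :: complex mat) *\<^sub>v 0\<^sub>v k = 0\<^sub>v m" by auto
    ultimately show "s \<in> {euclid_norm (0\<^sub>m m k *\<^sub>v x) | x. x \<in> carrier_vec k \<and> euclid_norm x \<le> 1}"
      using zero by (auto intro!: exI[of _ "0\<^sub>v k"])
  next
    fix s assume "s \<in> {euclid_norm (0\<^sub>m m k *\<^sub>v x) | x. x \<in> carrier_vec k \<and> euclid_norm x \<le> 1}"
    then obtain x where x: "x \<in> carrier_vec k" and s: "s = euclid_norm (0\<^sub>m m k *\<^sub>v x)" by blast
    have "(0\<^sub>m m k :: complex mat) *\<^sub>v x = 0\<^sub>v m" using x by auto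
    then show "s \<in> {0}" using s zero by simp
  qed
  then show ?thesis by (simp add: spectral_norm_def)
qed

text \<open>Here A U = U D with D diagonal, and I - U U^* annihilates U because U^* U = I. So the
  matrix inside the norm is zero.\<close>

lemma residual_norm_eigenvectors:
  assumes A: "A \<in> carrier_mat n n" and U: "U \<in> carrier_mat n r"
    and orth: "mat_adjoint U * U = 1\<^sub>m r"
    and eig: "\<And>j. j < r \<Longrightarrow> A *\<^sub>v col U j = a j \<cdot>\<^sub>v col U j"
  shows "residual_norm A U = 0"
proof -
  let ?D = "mat r r (\<lambda>(i, j). if i = j then a j else 0)"
  let ?R = "1\<^sub>m n - U * mat_adjoint U"
  have D: "?D \<in> carrier_mat r r" and R: "?R \<in> carrier_mat n n" and U': "mat_adjoint U \<in> carrier_mat r n"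
    using U by (auto intro!: minus_carrier_mat)
  have AU: "A * U = U * ?D"
  proof (rule eq_matI)
    fix i j assume "i < dim_row (U * ?D)" "j < dim_col (U * ?D)"
    then have ij: "i < n" "j < r" using U by auto
    have "(A * U) $$ (i, j) = (A *\<^sub>v col U j) $ i" using ij A U by simp
    also have "\<dots> = a j * U $$ (i, j)" unfolding eig[OF ij(2)] using ij U by simp
    finally have AU_ij: "(A * U) $$ (i, j) = a j * U $$ (i, j)" .
    have "(U * ?D) $$ (i, j) = (\<Sum>k<r. U $$ (i, k) * (if k = j then a j else 0))"
      using ij U by (simp add: scalar_prod_def atLeast0LessThan)
    also have "\<dots> = (\<Sum>k<r. if k = j then U $$ (i, k) * a j else 0)"
      by (intro sum.cong) auto
    finally show "(A * U) $$ (i, j) = (U * ?D) $$ (i, j)" using ij AU_ij by simp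
  qed (use A U in auto)
  have "?R * U = 1\<^sub>m n * U - U * mat_adjoint U * U"
    using U U' by (intro minus_mult_distrib_mat) auto
  also have "\<dots> = 0\<^sub>m n r"
    using U U' orth by (simp add: assoc_mult_mat[of U n r _ n _ r])
  finally have RU: "?R * U = 0\<^sub>m n r" .
  have "?R * A * U = ?R * (A * U)"
    using R A U by (rule assoc_mult_mat)
  also have "\<dots> = ?R * U * ?D"
    unfolding AU using R U D by (rule assoc_mult_mat[symmetric])
  also have "\<dots> = 0\<^sub>m n r"
    unfolding RU using D by simp
  finally show ?thesis
    using U spectral_norm_zero by (simp add: residual_norm_def)
qed

section \<open>Spans, the parametrized matrix and the conclusion\<close>

text \<open>The span of the columns is the column space, that is, the image of V. This supplies the
  coordinates x_k required by \<open>galerkin\<close>.\<close>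

lemma in_cspan_cols:
  assumes V: "V \<in> carrier_mat n d" and y: "y \<in> cspan n (set (cols V))"
  obtains z where "z \<in> carrier_vec d" "V *\<^sub>v z = y"
proof -
  interpret vec_space "TYPE(complex)" n .
  have "y \<in> col_space V" using y by (simp add: col_space_def)
  then show thesis using that V unfolding col_space_eq[OF V] by auto
qed

lemma in_own_cspan: "S \<subseteq> carrier_vec n \<Longrightarrow> y \<in> S \<Longrightarrow> y \<in> cspan n S"
proof -
  interpret vec_space "TYPE(complex)" n .
  show "S \<subseteq> carrier_vec n \<Longrightarrow> y \<in> S \<Longrightarrow> y \<in> cspan n S"
    using span_mem by auto
qed

lemma param_mat_hermitian:
  assumes "\<And>m. m \<in> {1..\<kappa>} \<Longrightarrow> A m \<in> carrier_mat n n \<and> hermitian_mat (A m)"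
  shows "hermitian_mat (param_mat n \<kappa> \<theta> A \<mu>)"
proof (rule hermitian_matI)
  fix i j assume ij: "i < n" "j < n"
  have "A m $$ (j, i) = cnj (A m $$ (i, j))" if "m \<in> {1..\<kappa>}" for m
    using assms[OF that] ij hermitian_mat_index by blast
  then show "param_mat n \<kappa> \<theta> A \<mu> $$ (j, i) = cnj (param_mat n \<kappa> \<theta> A \<mu> $$ (i, j))"
    using ij by (auto simp: param_mat_def intro!: sum.cong)
qed (simp add: param_mat_def)

theorem lemma1:
  fixes D :: "(real ^ 'p) set"
    and \<kappa> n r l j :: nat
    and \<theta> :: "nat \<Rightarrow> real ^ 'p \<Rightarrow> real"
    and A :: "nat \<Rightarrow> complex mat"
    and \<mu> :: "nat \<Rightarrow> real ^ 'p"
    and v :: "nat \<Rightarrow> nat \<Rightarrow> complex vec"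
    and V :: "complex mat"
    and w :: "real ^ 'p \<Rightarrow> nat \<Rightarrow> complex vec"
  assumes "compact D"
    and "\<And>m. m \<in> {1..\<kappa>} \<Longrightarrow> A m \<in> carrier_mat n n \<and> hermitian_mat (A m)"
    and "\<And>m. m \<in> {1..\<kappa>} \<Longrightarrow> real_analytic (\<theta> m)"
    and "1 \<le> r" and "r \<le> l" and "l < n"
    and "\<And>i. i \<in> {1..j} \<Longrightarrow> \<mu> i \<in> D"
    and "\<And>i. i \<in> {1..j} \<Longrightarrow> lowest_eigenvectors (param_mat n \<kappa> \<theta> A (\<mu> i)) l (v i)"
    and "orthonormal_basis_mat n (cspan n {v i k | i k. i \<in> {1..j} \<and> k \<in> {1..l}}) V"
    and "\<And>\<nu>. \<nu> \<in> D \<Longrightarrow> lowest_eigenvectors (mat_adjoint V * param_mat n \<kappa> \<theta> A \<nu> * V) r (w \<nu>)"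
  shows "\<forall>i\<in>{1..j}.
    residual_norm (param_mat n \<kappa> \<theta> A (\<mu> i)) (lifted_mat V r (w (\<mu> i))) = 0"
proof
  fix i assume i: "i \<in> {1..j}"
  let ?M = "\<lambda>i. param_mat n \<kappa> \<theta> A (\<mu> i)" and ?w = "w (\<mu> i)"
  have M: "?M i \<in> carrier_mat n n" for i by (simp add: param_mat_def)
  have M_herm: "hermitian_mat (?M i)" using assms(2) by (intro param_mat_hermitian)
  obtain d where V: "V \<in> carrier_mat n d"
    using assms(9) by (auto simp: orthonormal_basis_mat_def)
  have V_orth: "mat_adjoint V * V = 1\<^sub>m d"
    and V_span: "cspan n (set (cols V)) = cspan n {v i k | i k. i \<in> {1..j} \<and> k \<in> {1..l}}"
    using assms(9) mat_adjoint_mult_self_orthonormal[of V] V by (auto simp: orthonormal_basis_mat_def)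
  have v_carrier: "v i k \<in> carrier_vec n" if "i \<in> {1..j}" "k \<in> {1..l}" for i k
    using assms(8)[OF that(1)] that(2) carrier_matD(1)[OF M]
    by (auto simp: lowest_eigenvectors_def orthonormal_vecs_def)
  \<comment> \<open>The eigenvectors at the sampled point are among the generators of the subspace,
    hence in the range of V.\<close>
  have "\<exists>z. z \<in> carrier_vec d \<and> V *\<^sub>v z = v i k" if "k \<in> {1..l}" for k
  proof -
    have "v i k \<in> cspan n (set (cols V))"
      unfolding V_span using v_carrier i that by (intro in_own_cspan) auto
    then show ?thesis using in_cspan_cols[OF V] by blast
  qed
  then obtain x where x: "\<And>k. k \<in> {1..l} \<Longrightarrow> x k \<in> carrier_vec d \<and> V *\<^sub>v x k = v i k"
    by metis
  interpret G: galerkin n l d "?M i" V "v i" x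
  proof
    show "1 \<le> l" "l \<le> n" using assms(4-6) by linarith+
    show "x k \<in> carrier_vec d" "V *\<^sub>v x k = v i k" if "k \<in> {1..l}" for k
      using x[OF that] by simp_all
  qed (intro M M_herm assms(8)[OF i] V V_orth)+
  have w: "orthonormal_vecs d {1..r} ?w"
    and w_eig: "\<And>k. k \<in> {1..r} \<Longrightarrow> eigenvector G.B (?w k) (complex_of_real (kth_eigenvalue G.B k))"
    using assms(10)[OF assms(7)[OF i]] carrier_matD(2)[OF V] by (auto simp: lowest_eigenvectors_def)
  let ?U = "lifted_mat V r ?w"
  have U: "?U \<in> carrier_mat n r"
    using carrier_matD(1)[OF V] by (intro carrier_matI) (simp_all add: lifted_mat_def del: upt_Suc)
  \<comment> \<open>Columns are numbered from 0 and eigenvectors from 1, hence the shift by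
    \<open>Suc\<close>.\<close>
  have w_carrier: "?w (Suc k) \<in> carrier_vec d" if "k < r" for k
    using w that by (auto simp: orthonormal_vecs_def)
  have col_U: "col ?U k = V *\<^sub>v ?w (Suc k)" if "k < r" for k
    using that V w_carrier[OF that] unfolding lifted_mat_def by (subst col_mat_of_cols) (auto simp del: upt_Suc)
  have "mat_adjoint ?U * ?U = 1\<^sub>m (dim_col ?U)"
    using w U w_carrier V
    by (intro mat_adjoint_mult_self_orthonormal) (auto simp: orthonormal_vecs_def col_U G.isometry)
  then have U_orth: "mat_adjoint ?U * ?U = 1\<^sub>m r" using U by simp
  show "residual_norm (?M i) ?U = 0"
  proof (rule residual_norm_eigenvectors[OF M U U_orth])
    fix k assume k: "k < r"
    \<comment> \<open>Here r <= l enters: Suc k <= r <= l, so each of the r lifted eigenvalues is at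
      most the l-th eigenvalue at the sampled point.\<close>
    have "kth_eigenvalue G.B (Suc k) \<le> kth_eigenvalue (?M i) l"
      using k assms(5) by (intro G.kth_eigenvalue_B_le) auto
    moreover have "G.B *\<^sub>v ?w (Suc k) = complex_of_real (kth_eigenvalue G.B (Suc k)) \<cdot>\<^sub>v ?w (Suc k)"
      using w_eig[of "Suc k"] k by (auto simp: eigenvector_def)
    ultimately show "?M i *\<^sub>v col ?U k = complex_of_real (kth_eigenvalue G.B (Suc k)) \<cdot>\<^sub>v col ?U k"
      unfolding col_U[OF k] using w_carrier[OF k] by (intro G.lifted_eigenvector)
  qed
qed

end
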